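(* Suppose $\frac{2\delta}{\mu}<\alpha$ and $M\le M_0(\alpha)$, where $M_0(\alpha)=\dfrac{\alpha^2\sigma^2\gamma}{2(\alpha\mu-\delta)}$. Then $$V(x)=\frac{M}{\gamma}\left(1-e^{\tilde r_-(\alpha)x}\right),\qquad x\ge0,$$ is a concave, twice continuously differentiable solution on $[0,\infty)$ of the HJB equation $$0=\max_{\alpha\le a\le\beta}\left(\tfrac12\sigma^2a^2V''(x)+(a\mu-\delta)V'(x)-\gamma V(x)+M(1-V'(x))^+\right),\qquad V(0)=0,$$ and it satisfies $0\le V(x)\le\frac{M}{\gamma}$ for all $x>0$.
   Context: Parameters: real constants $\mu>0$, $\sigma>0$, $\gamma>0$, $\delta\ge0$, $M>0$, $0<\alpha<\beta<\infty$; $y^+=\max(y,0)$. $\tilde r_-(\alpha)=\dfrac{-(\alpha\mu-\delta-M)-\sqrt{(\alpha\mu-\delta-M)^2+2\gamma\sigma^2\alpha^2}}{\sigma^2\alpha^2}$. *)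

theory Defs
  imports "HOL-Analysis.Analysis"
begin

definition pos_part :: "real \<Rightarrow> real" where
  "pos_part y = max y 0"

text \<open>The maximum is attained; the library's \<^const>\<open>Max\<close> is only meaningful for finite sets.\<close>

definition is_maximum_on :: "('a \<Rightarrow> 'b::order) \<Rightarrow> 'a set \<Rightarrow> 'b \<Rightarrow> bool" where
  "is_maximum_on f S m \<longleftrightarrow> (\<exists>a\<in>S. f a = m) \<and> (\<forall>a\<in>S. f a \<le> m)"

text \<open>\<open>V\<close> is twice continuously differentiable on \<open>[0, \<infinity>)\<close>, with first and second derivatives
  \<open>V'\<close> and \<open>V''\<close>. Derivatives are one-sided at 0, so values of \<open>V\<close>, \<open>V'\<close>, \<open>V''\<close> at negative
  arguments are irrelevant. As 0 is a limit point of \<open>[0, \<infinity>)\<close>, \<open>V'\<close> and \<open>V''\<close> are uniquely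
  determined there by \<open>V\<close>.\<close>

definition C2_halfline :: "(real \<Rightarrow> real) \<Rightarrow> (real \<Rightarrow> real) \<Rightarrow> (real \<Rightarrow> real) \<Rightarrow> bool" where
  "C2_halfline V V' V'' \<longleftrightarrow>
     (\<forall>x\<ge>0. (V has_real_derivative V' x) (at x within {0..})) \<and>
     (\<forall>x\<ge>0. (V' has_real_derivative V'' x) (at x within {0..})) \<and>
     continuous_on {0..} V''"

definition C2_HJB_solution ::
  "real \<Rightarrow> real \<Rightarrow> real \<Rightarrow> real \<Rightarrow> real \<Rightarrow> real \<Rightarrow> real \<Rightarrow> (real \<Rightarrow> real) \<Rightarrow> bool" where
  "C2_HJB_solution \<mu> \<sigma> \<gamma> \<delta> M \<alpha> \<beta> V \<longleftrightarrow>
     (\<exists>V' V''. C2_halfline V V' V'' \<and>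
        (\<forall>x\<ge>0. is_maximum_on
           (\<lambda>a. 1 / 2 * \<sigma>\<^sup>2 * a\<^sup>2 * V'' x + (a * \<mu> - \<delta>) * V' x - \<gamma> * V x
                + M * pos_part (1 - V' x))
           {\<alpha>..\<beta>} 0)) \<and>
     V 0 = 0"

definition r_minus :: "real \<Rightarrow> real \<Rightarrow> real \<Rightarrow> real \<Rightarrow> real \<Rightarrow> real \<Rightarrow> real" where
  "r_minus \<mu> \<sigma> \<gamma> \<delta> M \<alpha> =
     (- (\<alpha> * \<mu> - \<delta> - M) - sqrt ((\<alpha> * \<mu> - \<delta> - M)\<^sup>2 + 2 * \<gamma> * \<sigma>\<^sup>2 * \<alpha>\<^sup>2)) / (\<sigma>\<^sup>2 * \<alpha>\<^sup>2)"

definition M0 :: "real \<Rightarrow> real \<Rightarrow> real \<Rightarrow> real \<Rightarrow> real \<Rightarrow> real" where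
  "M0 \<mu> \<sigma> \<gamma> \<delta> \<alpha> = \<alpha>\<^sup>2 * \<sigma>\<^sup>2 * \<gamma> / (2 * (\<alpha> * \<mu> - \<delta>))"

end

theory Submission
  imports Defs
begin

text \<open>Put \<open>s = - r_minus \<mu> \<sigma> \<gamma> \<delta> M \<alpha>\<close>. It is the positive root of
  \<open>q y = \<sigma>\<^sup>2 \<alpha>\<^sup>2 / 2 * y\<^sup>2 - (\<alpha> \<mu> - \<delta> - M) * y - \<gamma>\<close>, and
  \<open>V = M / \<gamma> * (1 - exp (- s x))\<close>, so that \<open>V' > 0\<close> and \<open>V'' = - s V' < 0\<close>.

  Two inequalities on \<open>s\<close> carry the proof. If \<open>s \<le> \<gamma> / M\<close>, then
  \<open>V' \<le> V' 0 = M s / \<gamma> \<le> 1\<close>, hence the positive part in the HJB equation opens as \<open>1 - V'\<close>, and the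
  equation at \<open>a = \<alpha>\<close> is \<open>q s = 0\<close> up to a factor. If \<open>s \<ge> \<mu> / (\<sigma>\<^sup>2 \<alpha>)\<close>, then the vertex
  \<open>\<mu> / (\<sigma>\<^sup>2 s)\<close> of the Hamiltonian, a concave parabola in \<open>a\<close>, lies at or to the left of \<open>\<alpha>\<close>, so
  that \<open>a = \<alpha>\<close> is the maximiser over \<open>[\<alpha>, \<beta>]\<close>.

  Since \<open>q\<close> is negative on \<open>(0, s)\<close> and positive beyond \<open>s\<close>, each inequality is a sign of \<open>q\<close> at
  one point. The condition \<open>q (\<gamma> / M) \<ge> 0\<close> is exactly \<open>M \<le> M0 \<mu> \<sigma> \<gamma> \<delta> \<alpha>\<close>. The condition
  \<open>q (\<mu> / (\<sigma>\<^sup>2 \<alpha>)) \<le> 0\<close> follows because \<open>2 \<delta> < \<alpha> \<mu>\<close> both absorbs the \<open>\<delta>\<close> term and bounds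
  \<open>M0 \<mu> \<sigma> \<gamma> \<delta> \<alpha>\<close> by \<open>\<alpha> \<sigma>\<^sup>2 \<gamma> / \<mu>\<close>.\<close>

lemma r_minus_quadratic:
  fixes \<mu> \<sigma> \<gamma> \<delta> M \<alpha> :: real
  assumes "\<sigma> > 0" "\<gamma> > 0" "\<alpha> > 0"
  defines "r \<equiv> r_minus \<mu> \<sigma> \<gamma> \<delta> M \<alpha>"
  shows "r < 0"
    and "1/2 * \<sigma>\<^sup>2 * \<alpha>\<^sup>2 * r\<^sup>2 + (\<alpha> * \<mu> - \<delta> - M) * r - \<gamma> = 0"
proof -
  define B where "B = \<alpha> * \<mu> - \<delta> - M"
  define K where "K = \<sigma>\<^sup>2 * \<alpha>\<^sup>2"
  define S where "S = sqrt (B\<^sup>2 + 2 * \<gamma> * K)"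
  have K: "K > 0" using assms by (simp add: K_def)
  have rK: "r = (- B - S) / K"
    by (simp add: r_def r_minus_def B_def K_def S_def mult.assoc)
  have "\<bar>B\<bar> < S"
    unfolding S_def using K assms(2) by (intro real_less_rsqrt) simp
  then show "r < 0"
    using K by (simp add: rK divide_simps)
  have S2: "S\<^sup>2 = B\<^sup>2 + 2 * \<gamma> * K"
    using K assms(2) by (simp add: S_def)
  have Kr: "K * r = - B - S" using K by (simp add: rK)
  have "2 * K * (1/2 * K * r\<^sup>2 + B * r - \<gamma>) = (K * r)\<^sup>2 + 2 * B * (K * r) - 2 * \<gamma> * K"
    by (simp add: power2_eq_square algebra_simps)
  also have "\<dots> = 0"
    unfolding Kr using S2 by (simp add: power2_eq_square algebra_simps)
  finally show "1/2 * \<sigma>\<^sup>2 * \<alpha>\<^sup>2 * r\<^sup>2 + (\<alpha> * \<mu> - \<delta> - M) * r - \<gamma> = 0"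
    using assms(1,3) by (auto simp: B_def K_def mult.assoc)
qed

text \<open>Eliminating \<open>b\<close> between the values at \<open>s\<close> and \<open>y\<close> leaves a product with one factor
  \<open>y - s\<close> and one positive factor, so the sign of the quadratic at \<open>y > 0\<close> locates \<open>y\<close>
  relative to the positive root.\<close>

lemma quadratic_sign_positive_root:
  fixes A b c s y :: real
  assumes "A \<ge> 0" "c > 0" "s > 0" "y > 0" and root: "A * s\<^sup>2 - b * s - c = 0"
  shows "0 \<le> A * y\<^sup>2 - b * y - c \<longleftrightarrow> s \<le> y"
    and "A * y\<^sup>2 - b * y - c \<le> 0 \<longleftrightarrow> y \<le> s"
proof -
  have "s * (A * y\<^sup>2 - b * y - c) = s * (A * y\<^sup>2 - b * y - c) - y * (A * s\<^sup>2 - b * s - c)"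
    using root by simp
  also have "\<dots> = (A * s * y + c) * (y - s)"
    by (simp add: power2_eq_square algebra_simps)
  finally have eq: "s * (A * y\<^sup>2 - b * y - c) = (A * s * y + c) * (y - s)" .
  have pos: "A * s * y + c > 0" using assms by (simp add: add_nonneg_pos)
  have "0 \<le> A * y\<^sup>2 - b * y - c \<longleftrightarrow> 0 \<le> s * (A * y\<^sup>2 - b * y - c)"
    using assms(3) by (simp add: zero_le_mult_iff)
  then show "0 \<le> A * y\<^sup>2 - b * y - c \<longleftrightarrow> s \<le> y"
    unfolding eq using pos by (simp add: zero_le_mult_iff)
  have "A * y\<^sup>2 - b * y - c \<le> 0 \<longleftrightarrow> s * (A * y\<^sup>2 - b * y - c) \<le> 0"
    using assms(3) by (simp add: mult_le_0_iff)
  then show "A * y\<^sup>2 - b * y - c \<le> 0 \<longleftrightarrow> y \<le> s"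
    unfolding eq using pos by (simp add: mult_le_0_iff)
qed

text \<open>The first bound gives \<open>V' \<le> 1\<close>, the second puts the maximum of the Hamiltonian over
  \<open>[\<alpha>, \<beta>]\<close> at \<open>\<alpha>\<close>. They hold because the quadratic is nonnegative at \<open>\<gamma> / M\<close> and nonpositive
  at \<open>\<mu> / (\<sigma>\<^sup>2 \<alpha>)\<close>.\<close>

lemma r_minus_bounds:
  fixes \<mu> \<sigma> \<gamma> \<delta> M \<alpha> :: real
  assumes "\<mu> > 0" "\<sigma> > 0" "\<gamma> > 0" "\<delta> \<ge> 0" "M > 0" "\<alpha> > 0"
    and \<delta>: "2 * \<delta> / \<mu> < \<alpha>" and M: "M \<le> M0 \<mu> \<sigma> \<gamma> \<delta> \<alpha>"
  defines "s \<equiv> - r_minus \<mu> \<sigma> \<gamma> \<delta> M \<alpha>"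
  shows "M * s \<le> \<gamma>" and "\<mu> \<le> \<sigma>\<^sup>2 * \<alpha> * s"
proof -
  let ?q = "\<lambda>y. 1/2 * \<sigma>\<^sup>2 * \<alpha>\<^sup>2 * y\<^sup>2 - (\<alpha> * \<mu> - \<delta> - M) * y - \<gamma>"
  have s: "s > 0" and root: "?q s = 0"
    using r_minus_quadratic[OF assms(2,3,6), of \<mu> \<delta> M] by (simp_all add: s_def)
  have A: "1/2 * \<sigma>\<^sup>2 * \<alpha>\<^sup>2 \<ge> 0" by simp
  note sgn = quadratic_sign_positive_root[OF A \<open>\<gamma> > 0\<close> s _ root]
  have d: "2 * \<delta> < \<alpha> * \<mu>" using \<delta> assms(1) by (simp add: field_simps)
  then have c: "\<alpha> * \<mu> - \<delta> > 0" using assms(4) by simp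
  have M': "2 * (\<alpha> * \<mu> - \<delta>) * M \<le> \<alpha>\<^sup>2 * \<sigma>\<^sup>2 * \<gamma>"
    using M c by (simp add: M0_def pos_le_divide_eq mult.commute)
  have "?q (\<gamma> / M) = \<gamma> / (2 * M\<^sup>2) * (\<alpha>\<^sup>2 * \<sigma>\<^sup>2 * \<gamma> - 2 * (\<alpha> * \<mu> - \<delta>) * M)"
    using assms(5) by (simp add: power2_eq_square field_simps)
  also have "\<dots> \<ge> 0" using M' assms(3) by simp
  finally have "s \<le> \<gamma> / M" using sgn(1)[of "\<gamma> / M"] assms(3,5) by simp
  then show "M * s \<le> \<gamma>" using assms(5) by (simp add: field_simps)
  have "\<mu> * M * \<alpha> \<le> 2 * (\<alpha> * \<mu> - \<delta>) * M"
  proof -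
    have "\<alpha> * \<mu> * M \<le> 2 * (\<alpha> * \<mu> - \<delta>) * M"
      using d assms(5) by (intro mult_right_mono) auto
    then show ?thesis by (simp add: mult_ac)
  qed
  also note M'
  finally have "\<alpha> * (\<mu> * M) \<le> \<alpha> * (\<alpha> * \<sigma>\<^sup>2 * \<gamma>)"
    by (simp add: power2_eq_square mult_ac)
  then have Mb: "\<mu> * M \<le> \<alpha> * \<sigma>\<^sup>2 * \<gamma>" using assms(6) by simp
  have "?q (\<mu> / (\<sigma>\<^sup>2 * \<alpha>)) =
      (\<mu> * (2 * \<delta> - \<alpha> * \<mu>) / 2 + (\<mu> * M - \<alpha> * \<sigma>\<^sup>2 * \<gamma>)) / (\<sigma>\<^sup>2 * \<alpha>)"
    using assms(2,6) by (simp add: power2_eq_square field_simps)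
  also have "\<dots> \<le> 0"
  proof (rule divide_nonpos_pos)
    have "\<mu> * (2 * \<delta> - \<alpha> * \<mu>) \<le> 0" using d assms(1) by (intro mult_nonneg_nonpos) auto
    then show "\<mu> * (2 * \<delta> - \<alpha> * \<mu>) / 2 + (\<mu> * M - \<alpha> * \<sigma>\<^sup>2 * \<gamma>) \<le> 0"
      using Mb by simp
    show "\<sigma>\<^sup>2 * \<alpha> > 0" using assms(2,6) by simp
  qed
  finally have "\<mu> / (\<sigma>\<^sup>2 * \<alpha>) \<le> s"
    using sgn(2)[of "\<mu> / (\<sigma>\<^sup>2 * \<alpha>)"] assms(1,2,6) by simp
  then show "\<mu> \<le> \<sigma>\<^sup>2 * \<alpha> * s" using assms(2,6) by (simp add: field_simps)
qed

theorem theorem3p12: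
  fixes \<mu> \<sigma> \<gamma> \<delta> M \<alpha> \<beta> :: real and V :: "real \<Rightarrow> real"
  assumes "\<mu> > 0" and "\<sigma> > 0" and "\<gamma> > 0" and "\<delta> \<ge> 0" and "M > 0"
    and "0 < \<alpha>" and "\<alpha> < \<beta>"
    and "2 * \<delta> / \<mu> < \<alpha>"
    and "M \<le> M0 \<mu> \<sigma> \<gamma> \<delta> \<alpha>"
    and "\<And>x. x \<ge> 0 \<Longrightarrow> V x = M / \<gamma> * (1 - exp (r_minus \<mu> \<sigma> \<gamma> \<delta> M \<alpha> * x))"
  shows "concave_on {0..} V \<and>
         C2_HJB_solution \<mu> \<sigma> \<gamma> \<delta> M \<alpha> \<beta> V \<and>
         (\<forall>x>0. 0 \<le> V x \<and> V x \<le> M / \<gamma>)"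
proof -
  define r where "r = r_minus \<mu> \<sigma> \<gamma> \<delta> M \<alpha>"
  \<comment> \<open>\<open>V\<close> is prescribed on \<open>[0, \<infinity>)\<close> only; \<open>W\<close> extends it smoothly to the whole line.\<close>
  define W where "W = (\<lambda>x. M / \<gamma> * (1 - exp (r * x)))"
  define V' where "V' = (\<lambda>x. - (M * r / \<gamma>) * exp (r * x))"
  define V'' where "V'' = (\<lambda>x. - (M * r\<^sup>2 / \<gamma>) * exp (r * x))"
  have VW: "V x = W x" if "x \<ge> 0" for x
    using assms(10)[OF that] by (simp add: W_def r_def)
  have r: "r < 0" and root: "1/2 * \<sigma>\<^sup>2 * \<alpha>\<^sup>2 * r\<^sup>2 + (\<alpha> * \<mu> - \<delta> - M) * r - \<gamma> = 0"
    using r_minus_quadratic[OF assms(2,3,6)] by (simp_all add: r_def)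
  have r1: "- (M * r) \<le> \<gamma>" and r2: "\<mu> \<le> - (\<sigma>\<^sup>2 * \<alpha> * r)"
    using r_minus_bounds[OF assms(1-6,8,9)] by (simp_all add: r_def)
  have e1: "exp (r * x) \<le> 1" if "x \<ge> 0" for x
    using that r by (simp add: mult_nonpos_nonneg)
  have dW: "(W has_real_derivative V' x) (at x within S)" for x S
    unfolding W_def V'_def using assms(3)
    by (auto intro!: derivative_eq_intros simp: field_simps)
  have dV': "(V' has_real_derivative V'' x) (at x within S)" for x S
    unfolding V''_def V'_def using assms(3)
    by (auto intro!: derivative_eq_intros simp: field_simps power2_eq_square)
  have dV: "(V has_real_derivative V' x) (at x within {0..})" if "x \<ge> 0" for x
    by (rule has_field_derivative_transform_within[OF dW zero_less_one]) (use that VW in auto)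
  have V'_nonneg: "V' x \<ge> 0" for x
    unfolding V'_def using r assms(3,5)
    by (simp add: divide_nonpos_pos mult_nonneg_nonpos mult_nonpos_nonneg)
  have V''_eq: "V'' x = r * V' x" for x
    by (simp add: V'_def V''_def power2_eq_square)
  have V''_nonpos: "V'' x \<le> 0" for x
    unfolding V''_eq using r V'_nonneg[of x] by (simp add: mult_nonpos_nonneg)
  have V'_le: "V' x \<le> 1" if "x \<ge> 0" for x
  proof -
    have "- (M * r / \<gamma>) \<le> 1" using r1 assms(3) by (simp add: field_simps)
    then have "V' x \<le> 1 * 1"
      unfolding V'_def using e1[OF that] by (intro mult_mono) auto
    then show ?thesis by simp
  qed

  have C2: "C2_halfline V V' V''"
    unfolding C2_halfline_def using dV dV' assms(3) by (auto simp: V''_def intro!: continuous_intros)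

  have max: "is_maximum_on
           (\<lambda>a. 1 / 2 * \<sigma>\<^sup>2 * a\<^sup>2 * V'' x + (a * \<mu> - \<delta>) * V' x - \<gamma> * V x
                + M * pos_part (1 - V' x)) {\<alpha>..\<beta>} 0" (is "is_maximum_on ?H _ _") if x: "x \<ge> 0" for x
  proof -
    have p: "pos_part (1 - V' x) = 1 - V' x" using V'_le[OF x] by (simp add: pos_part_def)
    have "?H \<alpha> = - (M / \<gamma>) * exp (r * x) *
        (1/2 * \<sigma>\<^sup>2 * \<alpha>\<^sup>2 * r\<^sup>2 + (\<alpha> * \<mu> - \<delta> - M) * r - \<gamma>)"
      unfolding p VW[OF x] unfolding W_def V'_def V''_def using assms(3)
      by (simp add: field_simps)
    then have H\<alpha>: "?H \<alpha> = 0" using root by simp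
    have "?H a \<le> 0" if a: "a \<in> {\<alpha>..\<beta>}" for a
    proof -
      have "?H a = ?H a - ?H \<alpha>" using H\<alpha> by simp
      \<comment> \<open>Since \<open>V'' = r V'\<close>, the difference splits off \<open>a - \<alpha>\<close> and \<open>V'\<close>; the last factor is the
        slope at the midpoint of \<open>\<alpha>\<close> and \<open>a\<close>, divided by \<open>V'\<close>.\<close>
      also have "\<dots> = (a - \<alpha>) * V' x * (\<mu> + \<sigma>\<^sup>2 * ((a + \<alpha>) / 2) * r)"
        unfolding V''_eq by (simp add: power2_eq_square field_simps)
      also have "\<dots> \<le> 0"
      proof -
        have "\<sigma>\<^sup>2 * ((a + \<alpha>) / 2) * r \<le> \<sigma>\<^sup>2 * \<alpha> * r"
          using a r by (intro mult_right_mono_neg mult_left_mono) auto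
        then have "\<mu> + \<sigma>\<^sup>2 * ((a + \<alpha>) / 2) * r \<le> 0" using r2 by simp
        then show ?thesis using a V'_nonneg[of x] by (intro mult_nonneg_nonpos) auto
      qed
      finally show ?thesis .
    qed
    then show ?thesis unfolding is_maximum_on_def using H\<alpha> assms(7) by (intro conjI bexI[of _ \<alpha>]) auto
  qed

  have "concave_on {0..} W"
    by (rule f''_le0_imp_concave[where f' = V' and f'' = V'']) (use dW dV' V''_nonpos in auto)
  then have "concave_on {0..} V"
    by (auto simp: concave_on_iff VW)
  moreover have "C2_HJB_solution \<mu> \<sigma> \<gamma> \<delta> M \<alpha> \<beta> V"
    unfolding C2_HJB_solution_def using C2 max VW[of 0] by (auto simp: W_def)
  moreover have "0 \<le> V x \<and> V x \<le> M / \<gamma>" if "x > 0" for x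
  proof -
    have "M / \<gamma> * (1 - exp (r * x)) \<le> M / \<gamma> * 1"
      using assms(3,5) by (intro mult_left_mono) auto
    then show ?thesis using that e1[of x] assms(3,5) by (simp add: VW W_def)
  qed
  ultimately show ?thesis by blast
qed

end
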